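(* Let $p,q\in(1,\infty)$ satisfy $p^{-1}+q^{-1}=1$. Let $X$ and $Y$ be real random variables on a common probability space and let $\beta:\mathbf{R}\to\mathbf{R}$ be a difference of two non-decreasing functions from $\mathbf{R}$ to $\mathbf{R}$. Assume that $X$, $\beta(Y)$ and $X\beta(Y)$ have finite expectations and that $0<\mathbf{A}_p[X]<\infty$. Then $$\big|\mathbf{Cov}[X,\beta(Y)]\big|\le \mathbf{\Delta}_p[X,Y]\,\mathbf{\Gamma}_p[X,Y,\beta],$$ where $$\mathbf{\Delta}_p[X,Y]=\frac{\mathbf{A}_p[r_{X|Y}(Y)]}{\mathbf{A}_p[X]},\qquad \mathbf{\Gamma}_p[X,Y,\beta]=\mathbf{A}_p[X]\,\mathbf{A}_q[\beta(Y)].$$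
   Context: For an integrable random variable $Z$ and $k\ge1$, $\mathbf{A}_k[Z]=\big(\mathbf{E}\big[|Z-\mathbf{E}[Z]|^k\big]\big)^{1/k}\in[0,\infty]$. The centered regression function is $r_{X|Y}(y)=\mathbf{E}[X\mid Y=y]-\mathbf{E}[X]$, so that $r_{X|Y}(Y)=\mathbf{E}[X\mid Y]-\mathbf{E}[X]$ almost surely. The convention $0\cdot\infty=0$ is used. *)

theory Defs
  imports "HOL-Probability.Probability"
begin

definition abs_central_norm :: "'a measure \<Rightarrow> real \<Rightarrow> ('a \<Rightarrow> real) \<Rightarrow> ennreal" where
  "abs_central_norm M k Z =
     (let I = \<integral>\<^sup>+\<omega>. ennreal (\<bar>Z \<omega> - (LINT x|M. Z x)\<bar> powr k) \<partial>M
      in if I = \<infinity> then \<infinity> else ennreal (enn2real I powr (1 / k)))"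

definition cov :: "'a measure \<Rightarrow> ('a \<Rightarrow> real) \<Rightarrow> ('a \<Rightarrow> real) \<Rightarrow> real" where
  "cov M X Z = (LINT \<omega>|M. (X \<omega> - (LINT x|M. X x)) * (Z \<omega> - (LINT x|M. Z x)))"

text \<open>A Borel version of \<open>y \<mapsto> E[X | Y = y]\<close>, i.e. a Borel factorisation through \<open>Y\<close> of the
  conditional expectation of \<open>X\<close> given the sigma-algebra generated by \<open>Y\<close>.  It is determined
  only up to null sets of the law of \<open>Y\<close>; such a version exists by lemma
  \<open>cond_exp_given_version_exists\<close>, and one is fixed by choice.\<close>

definition is_cond_exp_given ::
    "'a measure \<Rightarrow> ('a \<Rightarrow> real) \<Rightarrow> ('a \<Rightarrow> real) \<Rightarrow> (real \<Rightarrow> real) \<Rightarrow> bool" where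
  "is_cond_exp_given M X Y g \<longleftrightarrow>
     g \<in> borel_measurable borel \<and>
     (AE \<omega> in M. g (Y \<omega>) = real_cond_exp M (vimage_algebra (space M) Y borel) X \<omega>)"

definition cond_exp_given :: "'a measure \<Rightarrow> ('a \<Rightarrow> real) \<Rightarrow> ('a \<Rightarrow> real) \<Rightarrow> real \<Rightarrow> real" where
  "cond_exp_given M X Y = (SOME g. is_cond_exp_given M X Y g)"

definition centered_regression :: "'a measure \<Rightarrow> ('a \<Rightarrow> real) \<Rightarrow> ('a \<Rightarrow> real) \<Rightarrow> real \<Rightarrow> real" where
  "centered_regression M X Y y = cond_exp_given M X Y y - (LINT x|M. X x)"

definition Delta_dep :: "'a measure \<Rightarrow> real \<Rightarrow> ('a \<Rightarrow> real) \<Rightarrow> ('a \<Rightarrow> real) \<Rightarrow> ennreal" where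
  "Delta_dep M p X Y =
     abs_central_norm M p (\<lambda>\<omega>. centered_regression M X Y (Y \<omega>)) / abs_central_norm M p X"

text \<open>The second exponent \<open>q\<close> is the conjugate of \<open>p\<close>; it is an explicit argument.
  Products in \<open>ennreal\<close> satisfy \<open>0 * \<infinity> = 0\<close>.\<close>

definition Gamma_dep ::
    "'a measure \<Rightarrow> real \<Rightarrow> real \<Rightarrow> ('a \<Rightarrow> real) \<Rightarrow> ('a \<Rightarrow> real) \<Rightarrow> (real \<Rightarrow> real) \<Rightarrow> ennreal" where
  "Gamma_dep M p q X Y \<beta> = abs_central_norm M p X * abs_central_norm M q (\<lambda>\<omega>. \<beta> (Y \<omega>))"

lemma ennreal_factor_through:
  fixes f :: "'a \<Rightarrow> ennreal" and Y :: "'a \<Rightarrow> real"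
  assumes "f \<in> borel_measurable (vimage_algebra S Y borel)"
  shows "\<exists>g\<in>borel_measurable borel. \<forall>x\<in>S. f x = g (Y x)"
  using assms
proof (induction rule: borel_measurable_induct)
  case (cong f g)
  then show ?case by (simp add: space_vimage_algebra)
next
  case (set A)
  then obtain B where B: "B \<in> sets borel" "A = Y -` B \<inter> S"
    by (auto simp: sets_vimage_algebra2)
  then show ?case
    by (intro bexI[of _ "indicator B"]) (auto simp: indicator_def)
next
  case (mult u c)
  then obtain g where "g \<in> borel_measurable borel" "\<forall>x\<in>S. u x = g (Y x)" by blast
  then show ?case by (intro bexI[of _ "\<lambda>y. c * g y"]) auto
next
  case (add u v)
  then obtain g h where "g \<in> borel_measurable borel" "\<forall>x\<in>S. u x = g (Y x)"
    "h \<in> borel_measurable borel" "\<forall>x\<in>S. v x = h (Y x)" by blast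
  then show ?case by (intro bexI[of _ "\<lambda>y. h y + g y"]) auto
next
  case (seq U)
  then obtain g where g: "\<And>i. g i \<in> borel_measurable borel" "\<And>i x. x \<in> S \<Longrightarrow> U i x = g i (Y x)"
    by metis
  then show ?case
    by (intro bexI[of _ "\<lambda>y. SUP i. g i y"]) (auto simp: image_comp)
qed

lemma cond_exp_given_version_exists: "\<exists>g. is_cond_exp_given M X Y g"
proof -
  let ?F = "vimage_algebra (space M) Y borel"
  let ?f = "real_cond_exp M ?F X"
  have "(\<lambda>x. ennreal (?f x)) \<in> borel_measurable ?F" "(\<lambda>x. ennreal (- ?f x)) \<in> borel_measurable ?F"
    by simp_all
  from this[THEN ennreal_factor_through] obtain g h where
    g: "g \<in> borel_measurable borel" "\<forall>x\<in>space M. ennreal (?f x) = g (Y x)" and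
    h: "h \<in> borel_measurable borel" "\<forall>x\<in>space M. ennreal (- ?f x) = h (Y x)"
    by blast
  have "enn2real (g (Y x)) - enn2real (h (Y x)) = ?f x" if "x \<in> space M" for x
  proof -
    have "g (Y x) = ennreal (?f x)" "h (Y x) = ennreal (- ?f x)" using g h that by auto
    then show ?thesis by (cases "?f x \<ge> 0") (simp_all add: ennreal_neg)
  qed
  then have "is_cond_exp_given M X Y (\<lambda>y. enn2real (g y) - enn2real (h y))"
    using g h by (auto simp: is_cond_exp_given_def intro!: AE_I2)
  then show ?thesis by blast
qed

lemma is_cond_exp_given_cond_exp_given: "is_cond_exp_given M X Y (cond_exp_given M X Y)"
  unfolding cond_exp_given_def by (rule someI_ex[OF cond_exp_given_version_exists])

end

theory Submission
  imports Defs
begin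

text \<open>Since \<open>\<beta>(Y)\<close> is measurable with respect to the sigma-algebra generated by \<open>Y\<close>, the variable \<open>X\<close> may be
  replaced by \<open>E[X | Y]\<close> in the covariance, so that \<open>Cov[X, \<beta>(Y)] = E[r(Y) (\<beta>(Y) - E[\<beta>(Y)])]\<close> with the
  centered regression function \<open>r\<close>.  The claim is then Hoelder's inequality.  As Hoelder's inequality holds
  for extended nonnegative values with \<open>0 * \<infinity> = 0\<close>, neither norm has to be finite.\<close>

text \<open>The formula of \<open>abs_central_norm\<close> with the centering removed, so that
  Hoelder's inequality can be proved for arbitrary measurable functions and only later applied to
  centered ones.\<close>

definition lp_seminorm :: "'a measure \<Rightarrow> real \<Rightarrow> ('a \<Rightarrow> real) \<Rightarrow> ennreal" where
  "lp_seminorm M k f =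
     (let I = \<integral>\<^sup>+\<omega>. ennreal (\<bar>f \<omega>\<bar> powr k) \<partial>M
      in if I = \<infinity> then \<infinity> else ennreal (enn2real I powr (1 / k)))"

lemma abs_central_norm_eq_lp_seminorm:
  "abs_central_norm M k Z = lp_seminorm M k (\<lambda>\<omega>. Z \<omega> - (LINT x|M. Z x))"
  by (simp add: abs_central_norm_def lp_seminorm_def)

lemma lp_seminorm_eq_0_AE:
  assumes [measurable]: "f \<in> borel_measurable M" and "lp_seminorm M k f = 0"
  shows "AE \<omega> in M. f \<omega> = 0"
proof -
  let ?I = "\<integral>\<^sup>+\<omega>. ennreal (\<bar>f \<omega>\<bar> powr k) \<partial>M"
  \<comment> \<open>Finiteness has to be recorded as well: \<open>enn2real\<close> also sends
    \<infinity> to 0, so the second fact alone would not give \<open>?I = 0\<close>.\<close>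
  have "?I \<noteq> \<infinity>" "enn2real ?I = 0"
    using assms(2) by (auto simp: lp_seminorm_def Let_def ennreal_eq_0_iff split: if_splits)
  then have "?I = 0"
    by (simp add: enn2real_eq_0_iff)
  then have "AE \<omega> in M. ennreal (\<bar>f \<omega>\<bar> powr k) = 0"
    by (subst (asm) nn_integral_0_iff_AE) auto
  then show ?thesis
    by eventually_elim (simp add: ennreal_eq_0_iff)
qed

text \<open>A finite value excludes the branch \<infinity>, and the exponent \<open>1 / k\<close> is
  then undone by raising to the power \<open>k\<close>. This evaluates the integrals left over by
  Young's inequality.\<close>

lemma nn_integral_powr_eq_lp_seminorm_powr:
  assumes "0 < k" and "lp_seminorm M k f = ennreal a" and "0 \<le> a"
  shows "(\<integral>\<^sup>+\<omega>. ennreal (\<bar>f \<omega>\<bar> powr k) \<partial>M) = ennreal (a powr k)"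
proof -
  let ?I = "\<integral>\<^sup>+\<omega>. ennreal (\<bar>f \<omega>\<bar> powr k) \<partial>M"
  have fin: "?I \<noteq> \<infinity>"
    using assms(2) by (auto simp: lp_seminorm_def Let_def split: if_splits)
  then have "enn2real ?I powr (1 / k) = a"
    using assms(2,3) by (simp add: lp_seminorm_def Let_def)
  then have "a powr k = enn2real ?I"
    using assms(1) by (auto simp: powr_powr)
  then show ?thesis
    using fin by (simp add: ennreal_enn2real less_top)
qed

text \<open>For finite positive seminorms, integrate Young's inequality for the two functions
  divided by their seminorms. The degenerate values are treated separately and need no
  integrability.\<close>

lemma nn_integral_Holder:
  assumes pq: "1 < p" "1 < q" "1 / p + 1 / q = 1"
    and [measurable]: "f \<in> borel_measurable M" "g \<in> borel_measurable M"
  shows "(\<integral>\<^sup>+\<omega>. ennreal \<bar>f \<omega> * g \<omega>\<bar> \<partial>M) \<le> lp_seminorm M p f * lp_seminorm M q g"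
proof -
  \<comment> \<open>A zero seminorm comes first and covers 0 times \<infinity>: the product of the
    functions then vanishes almost everywhere, in agreement with the convention.\<close>
  consider "lp_seminorm M p f = 0 \<or> lp_seminorm M q g = 0"
    | "lp_seminorm M p f * lp_seminorm M q g = \<infinity>"
    | a b where "lp_seminorm M p f = ennreal a" "lp_seminorm M q g = ennreal b" "0 < a" "0 < b"
    by (cases "lp_seminorm M p f"; cases "lp_seminorm M q g")
       (auto simp: ennreal_mult_eq_top_iff less_le)
  then show ?thesis
  proof cases
    case 1
    then have "(AE \<omega> in M. f \<omega> = 0) \<or> (AE \<omega> in M. g \<omega> = 0)"
      by (auto intro: lp_seminorm_eq_0_AE)
    then have "AE \<omega> in M. ennreal \<bar>f \<omega> * g \<omega>\<bar> = 0"
      by auto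
    then have "(\<integral>\<^sup>+\<omega>. ennreal \<bar>f \<omega> * g \<omega>\<bar> \<partial>M) = 0"
      by (subst nn_integral_0_iff_AE) auto
    then show ?thesis
      by simp
  next
    case 2
    then show ?thesis
      by simp
  next
    case (3 a b)
    \<comment> \<open>Coefficients of \<open>\<bar>f \<omega>\<bar> powr p\<close> and
      \<open>\<bar>g \<omega>\<bar> powr q\<close> in Young's inequality for
      \<open>\<bar>f \<omega>\<bar> / a\<close> and \<open>\<bar>g \<omega>\<bar> / b\<close>. After
      integration the two terms become \<open>1 / p\<close> and \<open>1 / q\<close>, which sum to
      1.\<close>
    let ?u = "1 / (p * a powr p)" and ?v = "1 / (q * b powr q)"
    have young: "\<bar>f \<omega> * g \<omega>\<bar> \<le> a * b * (?u * \<bar>f \<omega>\<bar> powr p + ?v * \<bar>g \<omega>\<bar> powr q)" for \<omega>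
    proof -
      have "\<bar>f \<omega>\<bar> / a * (\<bar>g \<omega>\<bar> / b) \<le> (\<bar>f \<omega>\<bar> / a) powr p / p + (\<bar>g \<omega>\<bar> / b) powr q / q"
        using pq 3 by (intro Youngs_inequality) auto
      also have "\<dots> = ?u * \<bar>f \<omega>\<bar> powr p + ?v * \<bar>g \<omega>\<bar> powr q"
        using 3 by (simp add: powr_divide mult.commute)
      finally show ?thesis
        using 3 by (simp add: abs_mult field_simps)
    qed
    have "(\<integral>\<^sup>+\<omega>. ennreal \<bar>f \<omega> * g \<omega>\<bar> \<partial>M)
        \<le> (\<integral>\<^sup>+\<omega>. ennreal (a * b) * (ennreal ?u * ennreal (\<bar>f \<omega>\<bar> powr p)
              + ennreal ?v * ennreal (\<bar>g \<omega>\<bar> powr q)) \<partial>M)"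
      using young pq 3
      by (intro nn_integral_mono) (simp flip: ennreal_mult' ennreal_plus add: ennreal_leI)
    also have "\<dots> = ennreal (a * b) * (ennreal ?u * (\<integral>\<^sup>+\<omega>. ennreal (\<bar>f \<omega>\<bar> powr p) \<partial>M)
              + ennreal ?v * (\<integral>\<^sup>+\<omega>. ennreal (\<bar>g \<omega>\<bar> powr q) \<partial>M))"
      by (simp add: nn_integral_cmult nn_integral_add)
    also have "\<dots> = ennreal (a * b) * (ennreal ?u * ennreal (a powr p) + ennreal ?v * ennreal (b powr q))"
      using pq 3 by (simp add: nn_integral_powr_eq_lp_seminorm_powr)
    also have "\<dots> = ennreal (a * b * (?u * a powr p + ?v * b powr q))"
      using pq 3 by (simp flip: ennreal_mult' ennreal_plus)
    also have "?u * a powr p + ?v * b powr q = 1"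
      using pq 3 by simp
    finally show ?thesis
      using 3 by (simp add: ennreal_mult)
  qed
qed

lemma subalgebra_vimage_algebra:
  assumes "Y \<in> measurable M N"
  shows "subalgebra M (vimage_algebra (space M) Y N)"
  using assms by (auto simp: subalgebra_def sets_vimage_algebra2 measurable_def)

context prob_space
begin

text \<open>Almost surely the centered regression at \<open>Y\<close> is the conditional expectation
  of \<open>X\<close> minus its mean. The first two claims follow because conditioning preserves
  integrability and the mean, the third because a factor measurable in \<open>Y\<close> can be
  pulled out of the conditional expectation.\<close>

lemma
  assumes X: "integrable M X" and [measurable]: "Y \<in> borel_measurable M"
  shows integrable_centered_regression: "integrable M (\<lambda>\<omega>. centered_regression M X Y (Y \<omega>))"
    and integral_centered_regression: "(LINT \<omega>|M. centered_regression M X Y (Y \<omega>)) = 0"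
    and cov_eq_integral_centered_regression:
      "\<lbrakk>\<beta> \<in> borel_measurable borel; integrable M (\<lambda>\<omega>. \<beta> (Y \<omega>)); integrable M (\<lambda>\<omega>. X \<omega> * \<beta> (Y \<omega>))\<rbrakk>
       \<Longrightarrow> cov M X (\<lambda>\<omega>. \<beta> (Y \<omega>))
          = (LINT \<omega>|M. centered_regression M X Y (Y \<omega>) * (\<beta> (Y \<omega>) - (LINT x|M. \<beta> (Y x))))"
proof -
  define F where "F = vimage_algebra (space M) Y borel"
  have "subalgebra M F"
    unfolding F_def by (rule subalgebra_vimage_algebra) simp
  then interpret finite_measure_subalgebra M F
    by unfold_locales
  let ?r = "\<lambda>\<omega>. centered_regression M X Y (Y \<omega>)" and ?E = "real_cond_exp M F X"
  have version: "cond_exp_given M X Y \<in> borel_measurable borel"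
    "AE \<omega> in M. cond_exp_given M X Y (Y \<omega>) = ?E \<omega>"
    using is_cond_exp_given_cond_exp_given[of M X Y] by (simp_all add: is_cond_exp_given_def F_def)
  have [measurable]: "?r \<in> borel_measurable M"
    unfolding centered_regression_def using version(1) by measurable
  have [measurable]: "?E \<in> borel_measurable M" by simp
  have r: "AE \<omega> in M. ?r \<omega> = ?E \<omega> - expectation X"
    using version(2) by eventually_elim (simp add: centered_regression_def)
  show "integrable M ?r"
    using real_cond_exp_int(1)[OF X] by (subst integrable_cong_AE[OF _ _ r]) auto
  show "(LINT \<omega>|M. ?r \<omega>) = 0"
    using real_cond_exp_int[OF X] by (subst integral_cong_AE[OF _ _ r]) (auto simp: prob_space)
  assume [measurable]: "\<beta> \<in> borel_measurable borel"
    and \<beta>: "integrable M (\<lambda>\<omega>. \<beta> (Y \<omega>))" "integrable M (\<lambda>\<omega>. X \<omega> * \<beta> (Y \<omega>))"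
  define b where "b = (\<lambda>\<omega>. \<beta> (Y \<omega>) - (LINT x|M. \<beta> (Y x)))"
  have [measurable]: "X \<in> borel_measurable M" using X by simp
  have [measurable]: "b \<in> borel_measurable M" unfolding b_def by measurable
  have "Y \<in> borel_measurable F"
    unfolding F_def by (rule measurable_vimage_algebra1) simp
  then have b_F: "b \<in> borel_measurable F"
    unfolding b_def by measurable
  have b: "integrable M b" "(LINT \<omega>|M. b \<omega>) = 0"
    using \<beta> by (simp_all add: b_def prob_space)
  \<comment> \<open>Expanding the product leaves \<open>X \<omega> * \<beta> (Y \<omega>)\<close>
    minus a multiple of \<open>X \<omega>\<close>, both integrable.\<close>
  have bX: "integrable M (\<lambda>\<omega>. b \<omega> * X \<omega>)"
    using \<beta> X by (simp add: b_def left_diff_distrib mult.commute[of _ "X _"] right_diff_distrib)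
  \<comment> \<open>The pull-out property: \<open>b * ?E\<close> is integrable with the same
    integral as \<open>b * X\<close>.\<close>
  note bE = real_cond_exp_intg[OF bX b_F]
  have "cov M X (\<lambda>\<omega>. \<beta> (Y \<omega>)) = (LINT \<omega>|M. b \<omega> * X \<omega> - expectation X * b \<omega>)"
    unfolding cov_def b_def[symmetric] by (simp add: b_def algebra_simps)
  also have "\<dots> = (LINT \<omega>|M. b \<omega> * ?E \<omega> - expectation X * b \<omega>)"
    using b bX bE by simp
  also have "\<dots> = (LINT \<omega>|M. ?r \<omega> * b \<omega>)"
  proof (rule integral_cong_AE)
    show "AE \<omega> in M. b \<omega> * ?E \<omega> - expectation X * b \<omega> = ?r \<omega> * b \<omega>"
      using r by eventually_elim (simp add: left_diff_distrib right_diff_distrib mult.commute)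
  qed measurable
  finally show "cov M X (\<lambda>\<omega>. \<beta> (Y \<omega>)) = (LINT \<omega>|M. ?r \<omega> * (\<beta> (Y \<omega>) - (LINT x|M. \<beta> (Y x))))"
    by (simp add: b_def)
qed

end

text \<open>Without integrability the Bochner integral is 0 by default and the bound is trivial, so
  Hoelder's inequality can be used before the right-hand side is known to be finite.\<close>

lemma ennreal_abs_integral_le_nn_integral:
  fixes f :: "'a \<Rightarrow> real"
  shows "ennreal \<bar>LINT \<omega>|M. f \<omega>\<bar> \<le> (\<integral>\<^sup>+\<omega>. ennreal \<bar>f \<omega>\<bar> \<partial>M)"
proof (cases "integrable M f")
  case True
  then show ?thesis using integral_norm_bound_ennreal[OF True] by simp
qed (simp add: not_integrable_integral_eq)

theorem theorem7p1:
  fixes M :: "'a measure" and X Y :: "'a \<Rightarrow> real" and \<beta> :: "real \<Rightarrow> real" and p q :: real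
  assumes "prob_space M"
    and "1 < p" and "1 < q" and "1 / p + 1 / q = 1"
    and "X \<in> borel_measurable M" and "Y \<in> borel_measurable M"
    and "\<exists>f g :: real \<Rightarrow> real. mono f \<and> mono g \<and> (\<forall>y. \<beta> y = f y - g y)"
    and "integrable M X"
    and "integrable M (\<lambda>\<omega>. \<beta> (Y \<omega>))"
    and "integrable M (\<lambda>\<omega>. X \<omega> * \<beta> (Y \<omega>))"
    and "0 < abs_central_norm M p X" and "abs_central_norm M p X < \<infinity>"
  shows "ennreal \<bar>cov M X (\<lambda>\<omega>. \<beta> (Y \<omega>))\<bar> \<le> Delta_dep M p X Y * Gamma_dep M p q X Y \<beta>"
proof -
  interpret prob_space M by fact
  let ?r = "\<lambda>\<omega>. centered_regression M X Y (Y \<omega>)" and ?b = "\<lambda>\<omega>. \<beta> (Y \<omega>) - (LINT x|M. \<beta> (Y x))"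
  obtain f g :: "real \<Rightarrow> real" where fg: "mono f" "mono g" "\<beta> = (\<lambda>y. f y - g y)"
    using assms(7) by auto
  \<comment> \<open>Monotone real functions are Borel, hence so is their difference.\<close>
  have \<beta>: "\<beta> \<in> borel_measurable borel"
    unfolding fg(3) using fg(1,2)[THEN borel_measurable_mono] by measurable
  have meas: "?r \<in> borel_measurable M" "?b \<in> borel_measurable M"
    using integrable_centered_regression[OF assms(8,6)] assms(9) by auto
  have "ennreal \<bar>cov M X (\<lambda>\<omega>. \<beta> (Y \<omega>))\<bar> = ennreal \<bar>LINT \<omega>|M. ?r \<omega> * ?b \<omega>\<bar>"
    by (simp only: cov_eq_integral_centered_regression[OF assms(8,6) \<beta> assms(9,10)])
  also have "\<dots> \<le> (\<integral>\<^sup>+\<omega>. ennreal \<bar>?r \<omega> * ?b \<omega>\<bar> \<partial>M)"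
    by (rule ennreal_abs_integral_le_nn_integral)
  also have "\<dots> \<le> lp_seminorm M p ?r * lp_seminorm M q ?b"
    by (rule nn_integral_Holder[OF assms(2-4) meas])
  \<comment> \<open>The regression term already has mean 0, so centering it changes nothing.\<close>
  also have "\<dots> = abs_central_norm M p ?r * abs_central_norm M q (\<lambda>\<omega>. \<beta> (Y \<omega>))"
    by (simp add: abs_central_norm_eq_lp_seminorm integral_centered_regression[OF assms(8,6)])
  also have "\<dots> = Delta_dep M p X Y * Gamma_dep M p q X Y \<beta>"
  proof -
    \<comment> \<open>Cancellation in \<open>ennreal\<close> is legitimate because the divisor is
      neither 0 nor \<infinity>.\<close>
    have "abs_central_norm M p ?r / abs_central_norm M p X * abs_central_norm M p X = abs_central_norm M p ?r"
      using assms(11,12) by (simp add: ennreal_divide_times)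
    then show ?thesis
      by (simp add: Delta_dep_def Gamma_dep_def flip: mult.assoc)
  qed
  finally show ?thesis .
qed

end
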